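(* Let $W_n$ be the set of all vectors $\vec p=(p_1,\dots,p_l)$ (any length $l\ge1$) of positive integers with $p_1+\dots+p_l=n$. Then for every integer $n\ge2$, $$\mathop{\rm Le}\nolimits_{\langle1\rangle_n}\!\left(\tfrac12\right)=\sum_{\vec p\in W_n}\mathop{\rm Li}\nolimits_{\vec p}\!\left(\tfrac12\right)=(1-2^{1-n})\zeta(n),$$ and for every integer $n\ge1$, $$\mathop{\rm Li}\nolimits_{\langle1\rangle_n}\!\left(\tfrac12\right)=\sum_{\vec p\in W_n}(-1)^{n-l(\vec p)}\mathop{\rm Le}\nolimits_{\vec p}\!\left(\tfrac12\right)=\frac{\ln^n2}{n!}.$$
   Context: For positive integers $s_1,\dots,s_l$ and $|z|<1$: $\mathop{\rm Li}\nolimits_{s_1,\dots,s_l}(z)=\sum_{n_1>\dots>n_l\ge1}\frac{z^{n_1}}{n_1^{s_1}\cdots n_l^{s_l}}$ and $\mathop{\rm Le}\nolimits_{s_1,\dots,s_l}(z)=\sum_{n_1\ge\dots\ge n_l\ge1}\frac{z^{n_1}}{n_1^{s_1}\cdots n_l^{s_l}}$. $\langle1\rangle_n$ is the $n$-dimensional vector of ones, $l(\vec p)$ the length of $\vec p$, and $\zeta$ the Riemann zeta function. *)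

theory Defs
  imports "HOL-Analysis.Analysis"
begin

text \<open>
  A vector $\vec s = (s_1,\dots,s_l)$ is a list of natural numbers. Both series range over the
  index tuples as unordered sums; they converge absolutely for $|z| < 1$ (lemmas
  \<open>Li_summable\<close>, \<open>Le_summable\<close>). Only nonempty lists of positive integers are meaningful
  arguments.
\<close>

definition mpl_term :: "nat list \<Rightarrow> complex \<Rightarrow> nat list \<Rightarrow> complex" where
  "mpl_term s z ns = z ^ hd ns / (\<Prod>i<length s. of_nat (ns ! i) ^ (s ! i))"

definition strict_indices :: "nat \<Rightarrow> nat list set" where
  "strict_indices l = {ns. length ns = l \<and> sorted_wrt (>) ns \<and> (\<forall>k\<in>set ns. 1 \<le> k)}"

definition weak_indices :: "nat \<Rightarrow> nat list set" where
  "weak_indices l = {ns. length ns = l \<and> sorted_wrt (\<ge>) ns \<and> (\<forall>k\<in>set ns. 1 \<le> k)}"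

definition Li :: "nat list \<Rightarrow> complex \<Rightarrow> complex" where
  "Li s z = (\<Sum>\<^sub>\<infinity>ns\<in>strict_indices (length s). mpl_term s z ns)"

definition Le :: "nat list \<Rightarrow> complex \<Rightarrow> complex" where
  "Le s z = (\<Sum>\<^sub>\<infinity>ns\<in>weak_indices (length s). mpl_term s z ns)"

definition compositions :: "nat \<Rightarrow> nat list set" where
  "compositions n = {p. p \<noteq> [] \<and> (\<forall>k\<in>set p. 1 \<le> k) \<and> sum_list p = n}"

text \<open>The Dirichlet series of the Riemann zeta function; meaningful only for $\Re s > 1$.\<close>

definition zeta :: "complex \<Rightarrow> complex" where
  "zeta s = (\<Sum>k. 1 / of_nat (Suc k) powr s)"

lemma finite_compositions: "finite (compositions n)"
proof (rule finite_subset)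
  have len: "length p \<le> sum_list p" if "\<forall>k\<in>set p. 1 \<le> k" for p :: "nat list"
    using that by (induction p) auto
  show "compositions n \<subseteq> {p. set p \<subseteq> {..n} \<and> length p \<le> n}"
    using len member_le_sum_list by (fastforce simp: compositions_def)
qed (simp add: finite_lists_length_le)

lemma strict_indices_subset: "strict_indices l \<subseteq> weak_indices l"
proof
  fix ns assume ns: "ns \<in> strict_indices l"
  have "sorted_wrt (\<ge>) ns"
    by (rule sorted_wrt_mono_rel[of _ "(>)"]) (use ns in \<open>auto simp: strict_indices_def\<close>)
  then show "ns \<in> weak_indices l"
    using ns by (auto simp: strict_indices_def weak_indices_def)
qed

lemma Le_summable:
  assumes "s \<noteq> []" and z: "norm z < 1"
  shows "(\<lambda>ns. norm (mpl_term s z ns)) summable_on weak_indices (length s)"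
proof (rule nonneg_bdd_above_summable_on)
  let ?l = "length s" and ?W = "weak_indices (length s)"
  let ?g = "\<lambda>m. real m ^ ?l * norm z ^ m"
  have g: "summable ?g"
  proof (rule root_test_convergence)
    have "(\<lambda>n. root n (real n) ^ ?l * norm z) \<longlonglongrightarrow> 1 ^ ?l * norm z"
      by (intro tendsto_intros LIMSEQ_root)
    moreover have "\<forall>\<^sub>F n in sequentially. root n (real n) ^ ?l * norm z = root n (norm (?g n))"
      using eventually_gt_at_top[of 0]
      by eventually_elim (simp add: real_root_mult real_root_power real_root_power_cancel
          norm_mult norm_power)
    ultimately show "(\<lambda>n. root n (norm (?g n))) \<longlonglongrightarrow> norm z"
      using Lim_transform_eventually by fastforce
  qed (use z in auto)
  have bound: "sum (\<lambda>ns. norm (mpl_term s z ns)) F \<le> suminf ?g"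
    if F: "F \<subseteq> ?W" "finite F" for F
  proof -
    have t: "norm (mpl_term s z ns) \<le> norm z ^ hd ns" if "ns \<in> F" for ns
    proof -
      have "1 \<le> (\<Prod>i<?l. real (ns ! i) ^ (s ! i))"
        using that F by (intro prod_ge_1 one_le_power) (fastforce simp: weak_indices_def)
      then show ?thesis
        by (simp add: mpl_term_def norm_divide norm_power prod_norm[symmetric] divide_le_eq
            mult_right_le_one_le mult_le_cancel_left1)
    qed
    have c: "card {ns\<in>F. hd ns = m} \<le> m ^ ?l" for m
    proof -
      have "{ns\<in>F. hd ns = m} \<subseteq> {ns. set ns \<subseteq> {1..m} \<and> length ns = ?l}"
      proof safe
        fix ns k assume ns: "ns \<in> F" and k: "k \<in> set ns" and m: "m = hd ns"
        obtain a as where "ns = a # as" using k by (cases ns) auto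
        then show "k \<in> {1..hd ns}" using ns k F by (auto simp: weak_indices_def)
      qed (use F in \<open>auto simp: weak_indices_def\<close>)
      from card_mono[OF _ this] show ?thesis
        by (simp add: finite_lists_length_eq card_lists_length_eq)
    qed
    have "sum (\<lambda>ns. norm (mpl_term s z ns)) F \<le> (\<Sum>ns\<in>F. norm z ^ hd ns)"
      by (intro sum_mono t)
    also have "\<dots> = (\<Sum>m\<in>hd ` F. \<Sum>ns\<in>{ns\<in>F. hd ns = m}. norm z ^ hd ns)"
      using F by (intro sum.image_gen)
    also have "\<dots> = (\<Sum>m\<in>hd ` F. real (card {ns\<in>F. hd ns = m}) * norm z ^ m)"
      by (intro sum.cong) auto
    also have "\<dots> \<le> (\<Sum>m\<in>hd ` F. ?g m)"
      using c by (intro sum_mono mult_right_mono) (auto simp flip: of_nat_power)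
    also have "\<dots> \<le> suminf ?g"
      using F g by (intro sum_le_suminf) auto
    finally show ?thesis .
  qed
  then show "bdd_above (sum (\<lambda>ns. norm (mpl_term s z ns)) ` {F. F \<subseteq> ?W \<and> finite F})"
    by (intro bdd_aboveI2[of _ _ "suminf ?g"]) auto
qed auto

lemma Li_summable:
  assumes "s \<noteq> []" and "norm z < 1"
  shows "(\<lambda>ns. norm (mpl_term s z ns)) summable_on strict_indices (length s)"
  using Le_summable[OF assms] strict_indices_subset by (rule summable_on_subset_banach)

end

theory Submission
  imports Defs
begin

text \<open>
  Sum every series over the leading index \<open>m\<close> last. The coefficient of \<open>z\<^sup>m\<close> in
  $\mathrm{Le}_{\langle1\rangle_n}$ is $\frac1m h_{n-1}(1,\frac12,\dots,\frac1m)$, and grouping its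
  monomials by the distinct indices that occur gives $\sum_{\vec p}\mathrm{Li}_{\vec p}$;
  dually $\frac1m e_{n-1}(1,\dots,\frac1{m-1})$ gives the signed sum of the $\mathrm{Le}_{\vec p}$.
  Both coefficient identities follow by recursion on \<open>n\<close>, and both hold for all $|z|<1$.

  At \<open>z = 1/2\<close>, the identity
  $h_n(1,\dots,\frac1m)=\sum_{k=1}^m(-1)^{k-1}\binom mk k^{-n}$ exhibits
  $\mathrm{Le}_{\langle1\rangle_n}(\frac12)$ as the Euler transform of
  $\sum_k(-1)^{k-1}k^{-n}=(1-2^{1-n})\zeta(n)$. The formal power series of
  $\mathrm{Li}_{\langle1\rangle_n}$ is $(-\ln(1-X))^n/n!$, as both sides have the same derivative.
\<close>

section \<open>Truncated nested sums, with one relation \<open>R\<close> covering strict and weak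
  index tuples\<close>

definition indices :: "(nat \<Rightarrow> nat \<Rightarrow> bool) \<Rightarrow> nat \<Rightarrow> nat list set" where
  "indices R l = {ns. length ns = l \<and> sorted_wrt R ns \<and> (\<forall>k\<in>set ns. 1 \<le> k)}"

text \<open>A multiple harmonic sum truncated at \<open>m\<close>. For \<open>n\<close> ones and
  \<open>m \<ge> 1\<close> it is e_n(1, ..., 1/(m-1)) if \<open>R\<close> is \<open>(>)\<close>, and
  h_n(1, ..., 1/m) if \<open>R\<close> is \<open>(\<ge>)\<close>.\<close>

primrec hsum :: "(nat \<Rightarrow> nat \<Rightarrow> bool) \<Rightarrow> nat list \<Rightarrow> nat \<Rightarrow> complex" where
  "hsum R [] m = 1"
| "hsum R (a # s) m = (\<Sum>k | 1 \<le> k \<and> R m k. hsum R s k / of_nat k ^ a)"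

text \<open>Transitivity passes the bound \<open>m\<close> from the head to all later entries, so
  only the head has to be compared with \<open>m\<close>.\<close>

lemma indices_below_Suc:
  assumes "transp R"
  shows "{ns \<in> indices R (Suc l). \<forall>k\<in>set ns. R m k} =
    (\<lambda>(k, ns). k # ns) ` (SIGMA k:{k. 1 \<le> k \<and> R m k}. {ns \<in> indices R l. \<forall>j\<in>set ns. R k j})"
    (is "?L = ?f ` ?S")
proof (intro equalityI subsetI)
  fix ns assume "ns \<in> ?L"
  then show "ns \<in> ?f ` ?S"
    by (cases ns) (auto simp: indices_def image_iff)
next
  fix ns assume "ns \<in> ?f ` ?S"
  then show "ns \<in> ?L"
    using transpD[OF assms] by (auto simp: indices_def)
qed

lemma indices_Suc:
  "indices R (Suc l) =
    (\<lambda>(k, ns). k # ns) ` (SIGMA k:{1..}. {ns \<in> indices R l. \<forall>j\<in>set ns. R k j})"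
    (is "?L = ?f ` ?S")
proof (intro equalityI subsetI)
  fix ns assume "ns \<in> ?L"
  then show "ns \<in> ?f ` ?S"
    by (cases ns) (auto simp: indices_def image_iff)
qed (auto simp: indices_def)

text \<open>Unfolding the recursion of \<open>hsum\<close> peels off the head of the tuple.
  Finiteness is part of the induction because exchanging the iterated sum for a sum over pairs
  requires it.\<close>

lemma hsum_eq_sum_indices:
  assumes "transp R" and fin: "\<And>m. finite {k. 1 \<le> k \<and> R m k}"
  shows "finite {ns \<in> indices R (length s). \<forall>k\<in>set ns. R m k} \<and>
    hsum R s m = (\<Sum>ns | ns \<in> indices R (length s) \<and> (\<forall>k\<in>set ns. R m k).
      1 / (\<Prod>i<length s. of_nat (ns ! i) ^ (s ! i)))"
proof (induction s arbitrary: m)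
  case Nil
  have "{ns \<in> indices R 0. \<forall>k\<in>set ns. R m k} = {[]}"
    by (auto simp: indices_def)
  then show ?case by simp
next
  case (Cons a s)
  let ?B = "\<lambda>m. {ns \<in> indices R (length s). \<forall>k\<in>set ns. R m k}"
  have inj: "inj_on (\<lambda>(k, ns). k # ns) A" for A :: "(nat \<times> nat list) set"
    by (auto simp: inj_on_def)
  have "hsum R (a # s) m = (\<Sum>k | 1 \<le> k \<and> R m k. \<Sum>ns\<in>?B k.
      1 / (\<Prod>i<length s. of_nat (ns ! i) ^ (s ! i)) / of_nat k ^ a)"
    using Cons by (simp add: sum_divide_distrib)
  also have "\<dots> = (\<Sum>(k, ns)\<in>Sigma {k. 1 \<le> k \<and> R m k} ?B.
      1 / (\<Prod>i<length s. of_nat (ns ! i) ^ (s ! i)) / of_nat k ^ a)"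
    using fin Cons by (intro sum.Sigma) auto
  finally show ?case
    using fin Cons
    by (simp only: list.size add_Suc_right add_0_right indices_below_Suc[OF assms(1)]
        sum.reindex[OF inj])
      (auto simp: prod.lessThan_Suc_shift case_prod_unfold mult.commute simp del: prod.lessThan_Suc
         intro!: sum.cong)
qed

text \<open>Absolute summability allows grouping the tuples by their head \<open>m\<close>; each
  group is finite and contributes a value of \<open>hsum\<close>.\<close>

lemma has_sum_mpl:
  assumes "transp R" and fin: "\<And>m. finite {k. 1 \<le> k \<and> R m k}"
    and "s \<noteq> []" and sm: "(\<lambda>ns. norm (mpl_term s z ns)) summable_on indices R (length s)"
  shows "((\<lambda>m. z ^ m / of_nat m ^ hd s * hsum R (tl s) m) has_sum
      (\<Sum>\<^sub>\<infinity>ns\<in>indices R (length s). mpl_term s z ns)) {1..}"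
proof -
  obtain a t where s: "s = a # t"
    using \<open>s \<noteq> []\<close> by (cases s) auto
  let ?B = "\<lambda>m. {ns \<in> indices R (length t). \<forall>k\<in>set ns. R m k}"
  have inj: "inj_on (\<lambda>(k, ns). k # ns) A" for A :: "(nat \<times> nat list) set"
    by (auto simp: inj_on_def)
  have "(mpl_term s z has_sum (\<Sum>\<^sub>\<infinity>ns\<in>indices R (length s). mpl_term s z ns)) (indices R (length s))"
    using abs_summable_summable[OF sm] by simp
  then have *: "((\<lambda>(k, ns). mpl_term s z (k # ns)) has_sum
      (\<Sum>\<^sub>\<infinity>ns\<in>indices R (length s). mpl_term s z ns)) (Sigma {1..} ?B)"
    unfolding s list.size add_Suc_right add_0_right indices_Suc has_sum_reindex[OF inj]
    by (simp add: o_def case_prod_unfold)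
  have "((\<lambda>ns. mpl_term s z (m # ns)) has_sum z ^ m / of_nat m ^ a * hsum R t m) (?B m)" for m
    using hsum_eq_sum_indices[OF assms(1) fin, of t m]
    by (simp add: has_sum_finite_iff s mpl_term_def prod.lessThan_Suc_shift sum_distrib_left
        del: prod.lessThan_Suc)
  then show ?thesis
    using has_sum_SigmaD[OF *] by (simp add: s)
qed

lemma has_sum_Li:
  assumes "s \<noteq> []" "norm z < 1"
  shows "((\<lambda>m. z ^ m / of_nat m ^ hd s * hsum (>) (tl s) m) has_sum Li s z) {1..}"
  unfolding Li_def strict_indices_def indices_def[symmetric]
  by (intro has_sum_mpl)
    (use assms Li_summable[OF assms] in \<open>auto simp: strict_indices_def indices_def\<close>)

lemma has_sum_Le:
  assumes "s \<noteq> []" "norm z < 1"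
  shows "((\<lambda>m. z ^ m / of_nat m ^ hd s * hsum (\<ge>) (tl s) m) has_sum Le s z) {1..}"
  unfolding Le_def weak_indices_def indices_def[symmetric]
  by (intro has_sum_mpl)
    (use assms Le_summable[OF assms] in \<open>auto simp: weak_indices_def indices_def\<close>)

section \<open>Compositions and the coefficient identities\<close>

lemma length_composition_le: "p \<in> compositions n \<Longrightarrow> length p \<le> n"
proof -
  have "\<forall>k\<in>set p. 1 \<le> k \<Longrightarrow> length p \<le> sum_list p" for p :: "nat list"
    by (induction p) auto
  then show "p \<in> compositions n \<Longrightarrow> length p \<le> n"
    by (auto simp: compositions_def)
qed

lemma compositions_1: "compositions (Suc 0) = {[1]}"
proof -
  have "p = [1]" if "p \<in> compositions (Suc 0)" for p
    using that length_composition_le[OF that] by (cases p) (auto simp: compositions_def)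
  then show ?thesis by (auto simp: compositions_def)
qed

text \<open>A composition of \<open>Suc n\<close> either starts with 1, followed by a composition of
  \<open>n\<close>, or arises from one by raising its first part. For \<open>n = 0\<close> the
  composition \<open>[1]\<close> would be missed.\<close>

lemma sum_compositions_Suc:
  assumes "n > 0"
  shows "(\<Sum>p\<in>compositions (Suc n). f p) =
    (\<Sum>p\<in>compositions n. f (1 # p)) + (\<Sum>p\<in>compositions n. f (Suc (hd p) # tl p))"
proof -
  let ?g = "\<lambda>p :: nat list. Suc (hd p) # tl p"
  have "p \<in> (#) 1 ` compositions n \<union> ?g ` compositions n" if p: "p \<in> compositions (Suc n)" for p
  proof (cases p)
    case (Cons a q)
    show ?thesis
    proof (cases "a = 1")
      case True
      then show ?thesis using p Cons assms by (auto simp: compositions_def)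
    next
      case False
      then have "p = ?g ((a - 1) # q)" "(a - 1) # q \<in> compositions n"
        using p Cons by (auto simp: compositions_def)
      then show ?thesis by blast
    qed
  qed (use p in \<open>auto simp: compositions_def\<close>)
  moreover have "(#) 1 ` compositions n \<subseteq> compositions (Suc n)"
    by (auto simp: compositions_def)
  moreover have "?g p \<in> compositions (Suc n)" if "p \<in> compositions n" for p
    using that by (cases p) (auto simp: compositions_def)
  ultimately have eq: "compositions (Suc n) = (#) 1 ` compositions n \<union> ?g ` compositions n"
    by blast
  have pos: "hd p > 0" if "p \<in> compositions n" for p
    using that by (cases p) (auto simp: compositions_def)
  have "inj_on ?g (compositions n)"
    by (auto simp: inj_on_def compositions_def) (metis list.expand)
  moreover have "(#) 1 ` compositions n \<inter> ?g ` compositions n = {}"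
    using pos by fastforce
  ultimately show ?thesis
    by (simp add: eq sum.union_disjoint finite_compositions sum.reindex)
qed

text \<open>Applied with \<open>R\<close> strict, \<open>R'\<close> weak, \<open>c = 1\<close> and with \<open>R\<close> weak, \<open>R'\<close> strict, \<open>c = -1\<close>.\<close>

lemma sum_compositions_hsum:
  assumes R: "\<And>m (f :: nat \<Rightarrow> complex). m \<ge> 1 \<Longrightarrow>
      (\<Sum>k | 1 \<le> k \<and> R m k. f k) + c * f m = (\<Sum>k | 1 \<le> k \<and> R' m k. f k)"
    and "m \<ge> 1"
  shows "(\<Sum>p\<in>compositions (Suc n). c ^ (Suc n - length p) * (hsum R (tl p) m / of_nat m ^ hd p)) =
    hsum R' (replicate n 1) m / of_nat m"
  using \<open>m \<ge> 1\<close>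
proof (induction n arbitrary: m)
  case 0
  then show ?case by (simp add: compositions_1)
next
  case (Suc n)
  let ?C = "compositions (Suc n)"
  define Q where "Q m = (\<Sum>p\<in>?C. c ^ (Suc n - length p) * (hsum R (tl p) m / of_nat m ^ hd p))" for m
  \<comment> \<open>A new leading 1 turns the old head of \<open>p\<close> into the outermost
    summation inside \<open>hsum\<close>, and leaves the exponent of \<open>c\<close>
    unchanged.\<close>
  have "c ^ (Suc n - length p) * (hsum R p m / of_nat m) =
      (\<Sum>k | 1 \<le> k \<and> R m k. c ^ (Suc n - length p) * (hsum R (tl p) k / of_nat k ^ hd p)) / of_nat m"
    if "p \<in> ?C" for p
    using that by (cases p) (auto simp: compositions_def sum_distrib_left)
  then have "(\<Sum>p\<in>?C. c ^ (Suc n - length p) * (hsum R p m / of_nat m)) =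
      (\<Sum>k | 1 \<le> k \<and> R m k. Q k) / of_nat m"
    unfolding Q_def by (subst sum.swap) (simp add: sum_divide_distrib)
  \<comment> \<open>Raising the first part keeps the length, so one factor \<open>c\<close> is
    gained; the subtraction is exact since \<open>length p \<le> Suc n\<close>.\<close>
  moreover have "(\<Sum>p\<in>?C. c ^ (Suc (Suc n) - length p) * (hsum R (tl p) m / of_nat m ^ Suc (hd p))) =
      c * Q m / of_nat m"
    unfolding Q_def sum_distrib_left sum_divide_distrib
    by (intro sum.cong) (auto simp: Suc_diff_le length_composition_le mult_ac)
  moreover have "Suc (length (tl p)) = length p" if "p \<in> ?C" for p
    using that by (auto simp: compositions_def)
  ultimately have "(\<Sum>p\<in>compositions (Suc (Suc n)).
      c ^ (Suc (Suc n) - length p) * (hsum R (tl p) m / of_nat m ^ hd p)) =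
      ((\<Sum>k | 1 \<le> k \<and> R m k. Q k) + c * Q m) / of_nat m"
    by (simp add: sum_compositions_Suc add_divide_distrib)
  \<comment> \<open>The term \<open>c * Q m\<close> is the diagonal term \<open>k = m\<close> by
    which the ranges of \<open>R\<close> and \<open>R'\<close> differ.\<close>
  also have "\<dots> = (\<Sum>k | 1 \<le> k \<and> R' m k. Q k) / of_nat m"
    using R Suc.prems by simp
  also have "(\<Sum>k | 1 \<le> k \<and> R' m k. Q k) = hsum R' (replicate (Suc n) 1) m"
    using Suc.IH by (auto simp: Q_def intro!: sum.cong)
  finally show ?case .
qed

lemma has_sum_finite_sum:
  fixes f :: "'i \<Rightarrow> 'a \<Rightarrow> 'b :: topological_comm_monoid_add"
  assumes "finite I" "\<And>i. i \<in> I \<Longrightarrow> (f i has_sum S i) A"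
  shows "((\<lambda>x. \<Sum>i\<in>I. f i x) has_sum (\<Sum>i\<in>I. S i)) A"
  using assms by (induction I rule: finite_induct) (auto intro: has_sum_add)

text \<open>The run lengths of equal entries in a weakly decreasing \<open>n\<close>-tuple form a
  composition of \<open>n\<close>, and its distinct entries form a strict tuple.\<close>

lemma Le_ones_eq_sum_Li:
  assumes "norm z < 1" "n \<ge> 1"
  shows "Le (replicate n 1) z = (\<Sum>p\<in>compositions n. Li p z)"
proof -
  obtain l where n: "n = Suc l" using assms(2) by (cases n) auto
  have "((\<lambda>m. \<Sum>p\<in>compositions n. z ^ m / of_nat m ^ hd p * hsum (>) (tl p) m) has_sum
      (\<Sum>p\<in>compositions n. Li p z)) {1..}"
    using assms
    by (intro has_sum_finite_sum finite_compositions has_sum_Li) (auto simp: compositions_def)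
  moreover have "(\<Sum>p\<in>compositions n. z ^ m / of_nat m ^ hd p * hsum (>) (tl p) m) =
      z ^ m / of_nat m ^ 1 * hsum (\<ge>) (replicate l 1) m" if "m \<in> {1..}" for m
  proof -
    have "{k. 1 \<le> k \<and> k \<le> m} = insert m {k. 1 \<le> k \<and> k < m}" if "m \<ge> 1" for m :: nat
      using that by auto
    then have "(\<Sum>p\<in>compositions (Suc l). 1 ^ (Suc l - length p) * (hsum (>) (tl p) m / of_nat m ^ hd p)) =
        hsum (\<ge>) (replicate l 1) m / of_nat m"
      using that by (intro sum_compositions_hsum) auto
    from arg_cong[OF this, of "\<lambda>x. z ^ m * x"] show ?thesis
      by (simp add: n sum_distrib_left)
  qed
  ultimately have "((\<lambda>m. z ^ m / of_nat m ^ 1 * hsum (\<ge>) (replicate l 1) m) has_sum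
      (\<Sum>p\<in>compositions n. Li p z)) {1..}"
    by (subst (asm) has_sum_cong) auto
  from has_sum_unique[OF _ this] show ?thesis
    using has_sum_Le[of "replicate n 1" z] assms by (simp add: n)
qed

text \<open>Inclusion-exclusion over equalities of neighbouring indices: imposing
  \<open>n - length p\<close> of them gives the sign and leaves the weak sum for
  \<open>p\<close>.\<close>

lemma Li_ones_eq_sum_Le:
  assumes "norm z < 1" "n \<ge> 1"
  shows "Li (replicate n 1) z = (\<Sum>p\<in>compositions n. (-1) ^ (n - length p) * Le p z)"
proof -
  obtain l where n: "n = Suc l" using assms(2) by (cases n) auto
  have "((\<lambda>m. \<Sum>p\<in>compositions n. (-1) ^ (n - length p) *
      (z ^ m / of_nat m ^ hd p * hsum (\<ge>) (tl p) m)) has_sum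
      (\<Sum>p\<in>compositions n. (-1) ^ (n - length p) * Le p z)) {1..}"
    using assms
    by (intro has_sum_finite_sum finite_compositions has_sum_cmult_right has_sum_Le)
      (auto simp: compositions_def)
  moreover have "(\<Sum>p\<in>compositions n. (-1) ^ (n - length p) *
      (z ^ m / of_nat m ^ hd p * hsum (\<ge>) (tl p) m)) =
      z ^ m / of_nat m ^ 1 * hsum (>) (replicate l 1) m" if "m \<in> {1..}" for m
  proof -
    have "{k. 1 \<le> k \<and> k \<le> m} = insert m {k. 1 \<le> k \<and> k < m}" if "m \<ge> 1" for m :: nat
      using that by auto
    then have "(\<Sum>p\<in>compositions (Suc l). (-1) ^ (Suc l - length p) * (hsum (\<ge>) (tl p) m / of_nat m ^ hd p)) =
        hsum (>) (replicate l 1) m / of_nat m"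
      using that by (intro sum_compositions_hsum) auto
    from arg_cong[OF this, of "\<lambda>x. z ^ m * x"] show ?thesis
      by (simp add: n sum_distrib_left mult_ac)
  qed
  ultimately have "((\<lambda>m. z ^ m / of_nat m ^ 1 * hsum (>) (replicate l 1) m) has_sum
      (\<Sum>p\<in>compositions n. (-1) ^ (n - length p) * Le p z)) {1..}"
    by (subst (asm) has_sum_cong) auto
  from has_sum_unique[OF _ this] show ?thesis
    using has_sum_Li[of "replicate n 1" z] assms by (simp add: n)
qed

section \<open>Formal power series and the value of \<open>Li\<close> at 1/2\<close>

text \<open>The exponential generating function of the unsigned Stirling numbers of the first kind.\<close>

lemma fps_hsum_ones:
  "Abs_fps (\<lambda>m. hsum (>) (replicate n 1) m / of_nat m) =
    fps_const (1 / fact (Suc n)) * Abs_fps (\<lambda>m. 1 / of_nat m) ^ Suc n" (is "?F n = _ * ?L ^ _")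
proof (induction n)
  case 0
  then show ?case by simp
next
  case (Suc n)
  \<comment> \<open>This is 1/(1-X), so multiplying by it forms partial sums of
    coefficients.\<close>
  have L': "fps_deriv ?L = Abs_fps (\<lambda>_. 1)"
    by (simp add: fps_eq_iff del: of_nat_Suc)
  have "{k. Suc 0 \<le> k \<and> k < Suc m} = {1..m}" for m
    by auto
  \<comment> \<open>The term at \<open>k = 0\<close> vanishes because division by zero yields
    0.\<close>
  moreover have "(\<Sum>k=0..m. hsum (>) (replicate n 1) k / of_nat k) =
      (\<Sum>k=1..m. hsum (>) (replicate n 1) k / of_nat k)" for m
    by (intro sum.mono_neutral_right) auto
  ultimately have "fps_deriv (?F (Suc n)) = ?F n * Abs_fps (\<lambda>_. 1)"
    by (simp add: fps_eq_iff fps_mult_nth del: of_nat_Suc)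
  also have "\<dots> = fps_deriv (fps_const (1 / fact (Suc (Suc n))) * ?L ^ Suc (Suc n))"
    unfolding Suc fps_deriv_power fps_deriv_mult L'
    by (simp add: mult_ac fps_const_mult[symmetric] del: fps_const_mult of_nat_Suc power_Suc)
  \<comment> \<open>Equal derivatives suffice, as both constant terms are 0.\<close>
  finally show ?case
    unfolding fps_deriv_eq_iff by (simp add: fps_power_zeroth del: power_Suc hsum.simps replicate_Suc fact_Suc)
qed

lemma sums_harmonic_powser:
  fixes z :: complex
  assumes "norm z < 1"
  shows "(\<lambda>m. 1 / of_nat m * z ^ m) sums (- ln (1 - z))"
  using sums_minus[OF Ln_series'[of "- z"]] assms by simp

lemma Li_ones_half:
  "Li (replicate (Suc n) 1) (1/2) = of_real (ln 2) ^ Suc n / fact (Suc n)"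
proof -
  let ?L = "Abs_fps (\<lambda>m. 1 / of_nat m :: complex)"
  \<comment> \<open>Any point strictly between 1/2 and 1 would serve; convergence at 3/4 puts 1/2
    strictly inside the disc.\<close>
  have "conv_radius (\<lambda>m. 1 / of_nat m :: complex) \<ge> norm (3/4 :: complex)"
    by (intro conv_radius_geI sums_summable[OF sums_harmonic_powser]) simp
  then have rad: "ereal (norm (1/2 :: complex)) < fps_conv_radius ?L"
    by (simp add: fps_conv_radius_def) (erule less_le_trans[rotated], simp)
  have "ln (1 - 1/2 :: complex) = of_real (ln (1/2))"
    by (simp add: Ln_of_real[symmetric])
  then have L: "eval_fps ?L (1/2) = of_real (ln 2)"
    using sums_harmonic_powser[of "1/2"] by (simp add: eval_fps_def sums_iff ln_div)
  have "((\<lambda>m. fps_nth (fps_const (1 / fact (Suc n)) * ?L ^ Suc n) m * (1/2) ^ m)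
      has_sum Li (replicate (Suc n) 1) (1/2)) UNIV"
    unfolding fps_hsum_ones[symmetric]
    using has_sum_Li[of "replicate (Suc n) 1" "1/2"]
    by (subst has_sum_cong_neutral[where T = "{1..}"
          and g = "\<lambda>m. (1/2) ^ m / of_nat m * hsum (>) (replicate n 1) m"]) (auto simp: mult_ac)
  from sums_unique[OF has_sum_imp_sums[OF this]]
  have "Li (replicate (Suc n) 1) (1/2) = eval_fps (fps_const (1 / fact (Suc n)) * ?L ^ Suc n) (1/2)"
    by (simp add: eval_fps_def)
  also have "\<dots> = 1 / fact (Suc n) * eval_fps ?L (1/2) ^ Suc n"
    using rad less_le_trans[OF rad fps_conv_radius_power]
    by (simp add: eval_fps_mult eval_fps_power del: power_Suc)
  finally show ?thesis
    by (simp add: L)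
qed

section \<open>Binomial sums, the Euler transform and the value of \<open>Le\<close> at 1/2\<close>

text \<open>For \<open>n = 0\<close> this is the vanishing alternating binomial sum. For larger
  \<open>n\<close>, both sides have the same increments in \<open>m\<close>, and these
  telescope.\<close>

lemma hsum_ge_ones:
  assumes "m \<ge> 1"
  shows "hsum (\<ge>) (replicate n 1) m =
    (\<Sum>k=1..m. (-1) ^ (k - 1) * of_nat (m choose k) / of_nat k ^ n)"
  using assms
proof (induction n arbitrary: m)
  case 0
  have "(\<Sum>k\<le>m. (-1) ^ k * of_nat (m choose k) :: complex) = 0"
    using 0 by (intro choose_alternating_sum) auto
  moreover have "{..m} = insert 0 {1..m}" by auto
  moreover have "(\<Sum>k=1..m. (-1) ^ (k - 1) * of_nat (m choose k) :: complex) =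
      - (\<Sum>k=1..m. (-1) ^ k * of_nat (m choose k))"
    unfolding sum_negf[symmetric]
    by (intro sum.cong) (auto simp: power_eq_if)
  ultimately have "1 - (\<Sum>k=1..m. (-1) ^ (k - 1) * of_nat (m choose k) :: complex) = 0"
    by simp
  then show ?case by simp
next
  case (Suc n)
  define D where "D m = (\<Sum>k=1..m. (-1) ^ (k - 1) * of_nat (m choose k) / of_nat k ^ Suc n :: complex)" for m
  have step: "D (Suc m) - D m = hsum (\<ge>) (replicate n 1) (Suc m) / of_nat (Suc m)" for m
  proof -
    \<comment> \<open>The added term is zero because \<open>m choose Suc m = 0\<close>.\<close>
    have "D m = (\<Sum>k=1..Suc m. (-1) ^ (k - 1) * of_nat (m choose k) / of_nat k ^ Suc n)"
      by (simp add: D_def)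
    then have "D (Suc m) - D m = (\<Sum>k=1..Suc m. (-1) ^ (k - 1) *
        (of_nat (Suc m choose k) - of_nat (m choose k)) / of_nat k ^ Suc n)"
      unfolding D_def by (simp only: sum_subtractf[symmetric] diff_divide_distrib right_diff_distrib)
    \<comment> \<open>Pascal's rule leaves \<open>m choose (k - 1)\<close>, which equals k/(m+1)
      times \<open>Suc m choose k\<close>; the factor k lowers the exponent to
      \<open>n\<close>.\<close>
    also have "\<dots> = (\<Sum>k=1..Suc m. (-1) ^ (k - 1) * of_nat (Suc m choose k) / of_nat k ^ n / of_nat (Suc m))"
    proof (intro sum.cong refl)
      fix k assume "k \<in> {1..Suc m}"
      then obtain j where k: "k = Suc j" by (cases k) auto
      have "of_nat (Suc j) * of_nat (Suc m choose Suc j) = (of_nat (Suc m) * of_nat (m choose j) :: complex)"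
        by (metis Suc_times_binomial of_nat_mult)
      then have "of_nat (m choose j) = (of_nat (Suc j) * of_nat (Suc m choose Suc j) / of_nat (Suc m) :: complex)"
        by (simp add: field_simps del: of_nat_Suc binomial_Suc_Suc)
      moreover have "of_nat (Suc m choose k) - of_nat (m choose k) = (of_nat (m choose j) :: complex)"
        by (simp add: k)
      ultimately show "(-1) ^ (k - 1) * (of_nat (Suc m choose k) - of_nat (m choose k)) / of_nat k ^ Suc n =
          ((-1) ^ (k - 1) * of_nat (Suc m choose k) / of_nat k ^ n / of_nat (Suc m) :: complex)"
        by (simp add: k del: of_nat_Suc binomial_Suc_Suc)
    qed
    also have "\<dots> = hsum (\<ge>) (replicate n 1) (Suc m) / of_nat (Suc m)"
      using Suc.IH[of "Suc m"] by (simp add: sum_divide_distrib del: sum.cl_ivl_Suc binomial_Suc_Suc)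
    finally show ?thesis .
  qed
  have "D m = (\<Sum>k=1..m. hsum (\<ge>) (replicate n 1) k / of_nat k)" for m
  proof (induction m)
    case 0
    then show ?case by (simp add: D_def)
  next
    case (Suc m)
    then show ?case using step[of m] by (simp add: diff_eq_eq add.commute del: of_nat_Suc)
  qed
  moreover have "{k. 1 \<le> k \<and> k \<le> m} = {1..m}" by auto
  ultimately show ?case by (simp add: D_def)
qed

text \<open>The negative binomial series of (1-x)^(-k-1) at x = 1/2, shifted by \<open>k\<close> and
  normalised.\<close>

lemma sums_binomial_half:
  "(\<lambda>m. real (m choose k) / 2 ^ Suc m) sums 1"
proof -
  have "(- real (Suc k) gchoose n) * (-1/2) ^ n = real (n + k choose k) / 2 ^ n" for n
  proof -
    have "- real (Suc k) gchoose n = (-1) ^ n * (real (k + n) gchoose n)"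
      by (subst gbinomial_minus) simp
    also have "real (k + n) gchoose n = real (n + k choose k)"
      by (metis add.commute binomial_gbinomial binomial_symmetric add_diff_cancel_left' le_add1)
    finally have "(- real (Suc k) gchoose n) * (-1/2) ^ n =
        real (n + k choose k) * ((-1) ^ n * (-1/2) ^ n)"
      by simp
    also have "(-1) ^ n * (-1/2) ^ n = (1/2 :: real) ^ n"
      unfolding power_mult_distrib[symmetric] by simp
    finally show ?thesis
      by (simp add: power_one_over field_simps)
  qed
  moreover have "(1/2 :: real) powr - real (Suc k) = 2 ^ Suc k"
    by (subst powr_minus, subst powr_realpow) (simp_all add: power_one_over)
  ultimately have "(\<lambda>n. real (n + k choose k) / 2 ^ n) sums 2 ^ Suc k"
    using gen_binomial_real[of "-1/2" "- real (Suc k)"] by simp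
  from sums_divide[OF this, of "2 ^ Suc k"]
  have "(\<lambda>n. real (n + k choose k) / 2 ^ Suc (n + k)) sums 1"
    by (simp add: power_add mult_ac)
  \<comment> \<open>The terms with \<open>m < k\<close> vanish, so the shift by \<open>k\<close> can
    be undone.\<close>
  then show ?thesis
    by (subst (asm) sums_zero_iff_shift) (auto simp: binomial_eq_0)
qed

text \<open>For fixed \<open>k\<close> the weights \<open>(m choose k) / 2 ^ Suc m\<close> sum to 1
  over \<open>m\<close>, so exchanging the order of summation returns the sum of
  \<open>a\<close>.\<close>

lemma has_sum_euler_transform:
  fixes a :: "nat \<Rightarrow> complex"
  assumes "summable (\<lambda>k. norm (a k))"
  shows "((\<lambda>m. (\<Sum>k\<le>m. of_nat (m choose k) * a k) / 2 ^ Suc m) has_sum suminf a) UNIV"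
proof -
  let ?f = "\<lambda>(k, m). of_nat (m choose k) * a k / 2 ^ Suc m :: complex"
  have norm_f: "norm (?f (k, m)) = norm (a k) * (real (m choose k) / 2 ^ Suc m)" for k m
    by (simp add: norm_mult norm_divide norm_power)
  have bin: "((\<lambda>m. real (m choose k) / 2 ^ Suc m) has_sum 1) UNIV" for k
    using sums_binomial_half by (intro norm_summable_imp_has_sum) (auto simp: sums_iff)
  have norm_sum: "((\<lambda>m. norm (?f (k, m))) has_sum norm (a k)) UNIV" for k
    unfolding norm_f using has_sum_cmult_right[OF bin, of "norm (a k)"] by simp
  \<comment> \<open>The norms in row \<open>k\<close> add up to \<open>norm (a k)\<close>, which is
    summable by assumption; this justifies the exchange.\<close>
  have "(\<lambda>x. norm (?f x)) summable_on UNIV \<times> UNIV"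
    unfolding Infinite_Sum.abs_summable_on_Sigma_iff infsumI[OF norm_sum]
  proof (intro conjI ballI)
    show "(\<lambda>m. norm (?f (k, m))) summable_on UNIV" for k
      by (rule has_sum_imp_summable[OF norm_sum])
    show "(\<lambda>k. norm (norm (a k))) summable_on UNIV"
      using assms by (simp add: summable_on_UNIV_nonneg_real_iff)
  qed
  then have f: "(?f has_sum infsum ?f (UNIV \<times> UNIV)) (UNIV \<times> UNIV)"
    by (rule has_sum_infsum[OF abs_summable_summable])
  have "((\<lambda>m. ?f (k, m)) has_sum a k) UNIV" for k
  proof -
    have "((\<lambda>m. of_real (real (m choose k) / 2 ^ Suc m) * a k) has_sum of_real 1 * a k) UNIV"
      by (intro has_sum_cmult_left has_sum_of_real bin)
    then show ?thesis by simp
  qed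
  then have "(a has_sum infsum ?f (UNIV \<times> UNIV)) UNIV"
    by (rule has_sum_SigmaD[OF f])
  then have S: "infsum ?f (UNIV \<times> UNIV) = suminf a"
    by (rule sums_unique[OF has_sum_imp_sums])
  have "((\<lambda>k. ?f (k, m)) has_sum (\<Sum>k\<le>m. of_nat (m choose k) * a k) / 2 ^ Suc m) UNIV" for m
    by (subst has_sum_cong_neutral[where T = "{..m}" and g = "\<lambda>k. ?f (k, m)"])
      (auto simp: has_sum_finite_iff sum_divide_distrib)
  then show ?thesis
    by (intro has_sum_SigmaD[OF iffD1[OF has_sum_swap f[unfolded S]]]) simp
qed

text \<open>Subtracting the even-denominator terms twice from the zeta series makes it alternate.
  The absolute summability is the hypothesis of the Euler transform.\<close>

lemma sums_alternating_zeta: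
  assumes "n \<ge> 2"
  shows "(\<lambda>k. (-1) ^ k / of_nat (Suc k) ^ n) sums ((1 - 2 powi (1 - int n)) * zeta (of_nat n))"
    and "summable (\<lambda>k. norm ((-1) ^ k / of_nat (Suc k) ^ n :: complex))"
proof -
  let ?a = "\<lambda>k. 1 / of_nat (Suc k) ^ n :: complex"
  have "summable (\<lambda>k. inverse (real (Suc k) ^ n))"
    using inverse_power_summable[OF assms, where ?'a = real] by (subst summable_Suc_iff)
  then have sm: "summable (\<lambda>k. norm (?a k))"
    by (simp add: norm_divide norm_power inverse_eq_divide del: of_nat_Suc)
  then show "summable (\<lambda>k. norm ((-1) ^ k / of_nat (Suc k) ^ n :: complex))"
    by (simp add: norm_divide norm_power)
  have z: "?a sums zeta (of_nat n)"
    using summable_norm_cancel[OF sm] unfolding zeta_def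
    by (simp add: summable_sums_iff powr_nat' del: of_nat_Suc)
  \<comment> \<open>Odd \<open>k\<close> means an even denominator base \<open>Suc k\<close>;
    halving that base extracts the factor 2 * 2^(-n).\<close>
  let ?b = "\<lambda>k. if odd k then 2 * ?a k else 0"
  have "?b (2 * j + 1) = 2 powi (1 - int n) * ?a j" for j
  proof -
    have "of_nat (Suc (2 * j + 1)) = (2 * of_nat (Suc j) :: complex)" by simp
    then show ?thesis
      by (simp add: power_int_diff power_mult_distrib del: of_nat_Suc)
  qed
  then have "(\<lambda>j. ?b (2 * j + 1)) sums (2 powi (1 - int n) * zeta (of_nat n))"
    using sums_mult[OF z] by presburger
  then have "?b sums (2 powi (1 - int n) * zeta (of_nat n))"
    by (subst (asm) sums_mono_reindex) (auto simp: strict_mono_def elim!: oddE)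
  from sums_diff[OF z this]
  have "(\<lambda>k. ?a k - ?b k) sums ((1 - 2 powi (1 - int n)) * zeta (of_nat n))"
    by (simp add: algebra_simps)
  moreover have "?a k - ?b k = (-1) ^ k / of_nat (Suc k) ^ n" for k
    by (simp add: field_simps del: of_nat_Suc)
  ultimately show "(\<lambda>k. (-1) ^ k / of_nat (Suc k) ^ n) sums ((1 - 2 powi (1 - int n)) * zeta (of_nat n))"
    by simp
qed

lemma Le_ones_half:
  assumes "n \<ge> 2"
  shows "Le (replicate n 1) (1/2) = (1 - 2 powi (1 - int n)) * zeta (of_nat n)"
proof -
  obtain l where n: "n = Suc l" using assms by (cases n) auto
  let ?a = "\<lambda>k. (-1) ^ k / of_nat (Suc k) ^ n :: complex"
  have coeff: "hsum (\<ge>) (replicate l 1) (Suc m) / of_nat (Suc m) = (\<Sum>k\<le>m. of_nat (m choose k) * ?a k)" for m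
  proof -
    have "hsum (\<ge>) (replicate l 1) (Suc m) =
        (\<Sum>k\<le>m. (-1) ^ k * of_nat (Suc m choose Suc k) / of_nat (Suc k) ^ l)"
      by (subst hsum_ge_ones)
        (simp_all add: sum.atLeast_Suc_atMost_Suc_shift atLeast0AtMost del: of_nat_Suc binomial_Suc_Suc sum.cl_ivl_Suc)
    \<comment> \<open>Absorption trades the factor 1/(m+1) for 1/(k+1), raising the exponent from
      \<open>l\<close> to \<open>n\<close>.\<close>
    also have "\<dots> / of_nat (Suc m) = (\<Sum>k\<le>m. of_nat (m choose k) * ?a k)"
      unfolding sum_divide_distrib
    proof (intro sum.cong refl)
      fix k
      have "of_nat (Suc k) * of_nat (Suc m choose Suc k) = (of_nat (Suc m) * of_nat (m choose k) :: complex)"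
        by (metis Suc_times_binomial of_nat_mult)
      then have "of_nat (Suc m choose Suc k) = (of_nat (Suc m) * of_nat (m choose k) / of_nat (Suc k) :: complex)"
        by (simp add: field_simps del: of_nat_Suc binomial_Suc_Suc)
      then show "(-1) ^ k * of_nat (Suc m choose Suc k) / of_nat (Suc k) ^ l / of_nat (Suc m) =
          of_nat (m choose k) * ?a k"
        by (simp add: n mult_ac del: of_nat_Suc binomial_Suc_Suc)
    qed
    finally show ?thesis .
  qed
  have "(1/2) ^ Suc m / of_nat (Suc m) * hsum (\<ge>) (replicate l 1) (Suc m) =
      (\<Sum>k\<le>m. of_nat (m choose k) * ?a k) / 2 ^ Suc m" for m
    unfolding coeff[symmetric] by (simp add: power_one_over field_simps del: of_nat_Suc hsum.simps)
  \<comment> \<open>Leading indices start at 1 and the Euler transform at 0; the shift also produces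
    its weight \<open>2 ^ Suc m\<close>.\<close>
  moreover have "{1..} = range Suc"
    by (auto simp: image_iff Suc_le_eq gr0_conv_Suc)
  then have "((\<lambda>m. (1/2) ^ m / of_nat m * hsum (\<ge>) (replicate l 1) m) has_sum
      Le (replicate n 1) (1/2)) (range Suc)"
    using has_sum_Le[of "replicate n 1" "1/2"] by (simp add: n)
  ultimately have "((\<lambda>m. (\<Sum>k\<le>m. of_nat (m choose k) * ?a k) / 2 ^ Suc m) has_sum
      Le (replicate n 1) (1/2)) UNIV"
    unfolding has_sum_reindex[OF inj_Suc] o_def by simp
  from has_sum_unique[OF this has_sum_euler_transform] show ?thesis
    using sums_alternating_zeta[OF assms] by (simp add: sums_iff)
qed

theorem theorem8:
  shows "(\<forall>n::nat. 2 \<le> n \<longrightarrow>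
            Le (replicate n 1) (1/2) = (\<Sum>p\<in>compositions n. Li p (1/2)) \<and>
            (\<Sum>p\<in>compositions n. Li p (1/2)) = (1 - 2 powi (1 - int n)) * zeta (of_nat n)) \<and>
         (\<forall>n::nat. 1 \<le> n \<longrightarrow>
            Li (replicate n 1) (1/2)
              = (\<Sum>p\<in>compositions n. (-1) ^ (n - length p) * Le p (1/2)) \<and>
            (\<Sum>p\<in>compositions n. (-1) ^ (n - length p) * Le p (1/2))
              = of_real (ln 2) ^ n / fact n)"
proof (intro conjI allI impI)
  fix n :: nat assume "2 \<le> n"
  then show Le: "Le (replicate n 1) (1/2) = (\<Sum>p\<in>compositions n. Li p (1/2))"
    by (intro Le_ones_eq_sum_Li) auto
  from \<open>2 \<le> n\<close> show "(\<Sum>p\<in>compositions n. Li p (1/2)) = (1 - 2 powi (1 - int n)) * zeta (of_nat n)"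
    unfolding Le[symmetric] by (rule Le_ones_half)
next
  fix n :: nat assume "1 \<le> n"
  then show Li: "Li (replicate n 1) (1/2) =
      (\<Sum>p\<in>compositions n. (-1) ^ (n - length p) * Le p (1/2))"
    by (intro Li_ones_eq_sum_Le) auto
  from \<open>1 \<le> n\<close> obtain l where "n = Suc l"
    by (cases n) auto
  then show "(\<Sum>p\<in>compositions n. (-1) ^ (n - length p) * Le p (1/2)) = of_real (ln 2) ^ n / fact n"
    unfolding Li[symmetric] using Li_ones_half by simp
qed

end
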